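(* Let $\theta=(\lambda,\psi)\in\Theta$ and let $j\in\{1,\dots,d_1\}$. Suppose that the score for the scale parameters satisfies, for $m=1,\dots,d_1$, $$s_m(\theta;y)=\frac{1}{f_\theta(y)}\int\nabla_m f_\theta(y\mid w)\,\nu(\mathrm dw)=\frac{1}{f_\theta(y)}\int\{\nabla_{(3)}h(y,\psi,\Lambda w)\}^{\mathsf T}\{\nabla_m\Lambda(\lambda)\}w\,\nu(\mathrm dw)$$ (i.e. the derivatives exist and can be moved inside the integral) at $\theta$; that $\Lambda(\lambda)=\operatorname{diag}(\lambda_{(1)},\dots,\lambda_{(q)})$, where each diagonal element $\lambda_{(l)}$ is one of $\lambda_1,\dots,\lambda_{d_1}$; and that $\theta_j=\lambda_j=0$. Then $\mathcal I(\theta)e_j=0$, where $e_j$ is the $j$th standard basis vector in $\mathbb R^d$.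
   Context: Let $Y\in\mathbb R^r$ be a random vector and $W\in\mathbb R^q$ a vector of random effects with distribution $\nu$, whose elements are independent with mean zero and unit variance. The parameter is $\theta=(\lambda,\psi)\in\Theta\subseteq\mathbb R^{d_1}\times\mathbb R^{d_2}$, $d=d_1+d_2$. Given $W=w$, $Y$ has conditional density $f_\theta(y\mid w)=h(y,\psi,\Lambda(\lambda)w)$ with respect to a measure $\gamma$, where $\Lambda=\Lambda(\lambda)\in\mathbb R^{q\times q}$ is a parameter matrix and $h:\mathbb R^r\times\mathbb R^{d_2}\times\mathbb R^q\to[0,\infty)$ is known. The marginal density of $Y$ against $\gamma$ is $f_\theta(y)=\int h(y,\psi,\Lambda w)\,\nu(\mathrm dw)$. The score is $s(\theta;y)=\nabla\log f_\theta(y)$ (gradient in $\theta$), with $m$th element $s_m$, and $\mathcal I(\theta)=\operatorname{cov}_\theta\{s(\theta;Y)\}$ is the Fisher information of one observation. $\nabla_m$ is the partial derivative with respect to $\theta_m$, acting elementwise on matrices; $\nabla_{(3)}h(y,\psi,\Lambda w)$ is the gradient of $h(y,\psi,\cdot)$ evaluated at $\Lambda w$. The map $l\mapsto\lambda_{(l)}$ (which $\lambda_m$ sits in the $l$th diagonal position) is fixed; the same $\lambda_m$ may appear in several positions. *)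

theory Defs
  imports "HOL-Probability.Probability"
begin

section \<open>Partial derivatives\<close>

definition partially_differentiable :: "'n::finite \<Rightarrow> (real^'n \<Rightarrow> real) \<Rightarrow> real^'n \<Rightarrow> bool"
  where "partially_differentiable m g x \<longleftrightarrow>
    (\<lambda>t::real. g (x + t *\<^sub>R axis m 1)) field_differentiable (at 0)"

definition partial :: "'n::finite \<Rightarrow> (real^'n \<Rightarrow> real) \<Rightarrow> real^'n \<Rightarrow> real"
  where "partial m g x = deriv (\<lambda>t::real. g (x + t *\<^sub>R axis m 1)) 0"

definition partial_mat ::
    "'n::finite \<Rightarrow> (real^'n \<Rightarrow> real^'b^'a) \<Rightarrow> real^'n \<Rightarrow> real^'b^'a"
  where "partial_mat m A x = (\<chi> k l. partial m (\<lambda>z. A z $ k $ l) x)"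

definition gradient :: "(real^'n::finite \<Rightarrow> real) \<Rightarrow> real^'n \<Rightarrow> real^'n"
  where "gradient g x = (\<chi> m. partial m g x)"

definition diag :: "real^'n \<Rightarrow> real^'n^'n"
  where "diag v = (\<chi> k l. if k = l then v $ k else 0)"

definition cov_matrix :: "'s measure \<Rightarrow> ('s \<Rightarrow> real^'n) \<Rightarrow> real^'n^'n"
  where "cov_matrix M X = (\<chi> i k.
    \<integral>s. (X s $ i - (\<integral>u. X u $ i \<partial>M)) * (X s $ k - (\<integral>u. X u $ k \<partial>M)) \<partial>M)"

section \<open>The mixed model\<close>

text \<open>
  A parameter \<open>\<theta> = (\<lambda>, \<psi>)\<close> is a vector indexed by the disjoint sum of the index types of
  \<open>\<lambda>\<close> and \<open>\<psi>\<close>; \<open>Inl m\<close> is the position of the scale parameter \<open>\<lambda>\<^sub>m\<close> in \<open>\<theta>\<close>.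
\<close>

definition scale_part :: "real^('d1::finite + 'd2::finite) \<Rightarrow> real^'d1"
  where "scale_part \<theta> = (\<chi> m. \<theta> $ Inl m)"

definition psi_part :: "real^('d1::finite + 'd2::finite) \<Rightarrow> real^'d2"
  where "psi_part \<theta> = (\<chi> m. \<theta> $ Inr m)"

text \<open>
  The Bochner integral is 0 for non-integrable functions, so variance 1 entails that
  the components are square integrable, and hence that their means exist.
\<close>

definition random_effects_law :: "(real^'q) measure \<Rightarrow> bool"
  where "random_effects_law \<nu> \<longleftrightarrow>
    prob_space \<nu> \<and> sets \<nu> = sets borel \<and>
    prob_space.indep_vars \<nu> (\<lambda>_. borel) (\<lambda>l w. w $ l) UNIV \<and>
    (\<forall>l. prob_space.expectation \<nu> (\<lambda>w. w $ l) = 0) \<and>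
    (\<forall>l. prob_space.variance \<nu> (\<lambda>w. w $ l) = 1)"

definition cond_density ::
    "(real^'r \<Rightarrow> real^'d2 \<Rightarrow> real^'q \<Rightarrow> real) \<Rightarrow> (real^'d1 \<Rightarrow> real^'q^'q)
      \<Rightarrow> real^('d1::finite + 'd2::finite) \<Rightarrow> real^'r \<Rightarrow> real^'q \<Rightarrow> real"
  where "cond_density h \<Lambda> \<theta> y w = h y (psi_part \<theta>) (\<Lambda> (scale_part \<theta>) *v w)"

definition marg_density ::
    "(real^'q) measure \<Rightarrow> (real^'r \<Rightarrow> real^'d2 \<Rightarrow> real^'q \<Rightarrow> real) \<Rightarrow> (real^'d1 \<Rightarrow> real^'q^'q)
      \<Rightarrow> real^('d1::finite + 'd2::finite) \<Rightarrow> real^'r \<Rightarrow> real"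
  where "marg_density \<nu> h \<Lambda> \<theta> y = (\<integral>w. cond_density h \<Lambda> \<theta> y w \<partial>\<nu>)"

definition mixed_model ::
    "(real^('d1::finite + 'd2::finite)) set \<Rightarrow> (real^'q) measure \<Rightarrow> (real^'r) measure
      \<Rightarrow> (real^'r \<Rightarrow> real^'d2 \<Rightarrow> real^'q \<Rightarrow> real) \<Rightarrow> (real^'d1 \<Rightarrow> real^'q^'q) \<Rightarrow> bool"
  where "mixed_model \<Theta> \<nu> \<gamma> h \<Lambda> \<longleftrightarrow>
    random_effects_law \<nu> \<and> sets \<gamma> = sets borel \<and>
    (\<forall>y \<psi> u. 0 \<le> h y \<psi> u) \<and>
    (\<forall>\<theta>\<in>\<Theta>. (\<lambda>(y, u). h y (psi_part \<theta>) u) \<in> borel_measurable (borel \<Otimes>\<^sub>M borel)) \<and>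
    (\<forall>\<theta>\<in>\<Theta>. AE w in \<nu>. (\<integral>\<^sup>+ y. ennreal (cond_density h \<Lambda> \<theta> y w) \<partial>\<gamma>) = 1)"

definition obs_law ::
    "(real^'q) measure \<Rightarrow> (real^'r) measure \<Rightarrow> (real^'r \<Rightarrow> real^'d2 \<Rightarrow> real^'q \<Rightarrow> real)
      \<Rightarrow> (real^'d1 \<Rightarrow> real^'q^'q) \<Rightarrow> real^('d1::finite + 'd2::finite) \<Rightarrow> (real^'r) measure"
  where "obs_law \<nu> \<gamma> h \<Lambda> \<theta> = density \<gamma> (\<lambda>y. ennreal (marg_density \<nu> h \<Lambda> \<theta> y))"

text \<open>
  The model formula for \<open>f\<^sub>\<theta>(y)\<close> makes sense for every \<open>\<theta>\<close>, so the derivatives are ordinary two-sided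
  ones even if \<open>\<theta>\<close> lies on the boundary of the parameter set.
\<close>

definition score ::
    "(real^'q) measure \<Rightarrow> (real^'r \<Rightarrow> real^'d2 \<Rightarrow> real^'q \<Rightarrow> real) \<Rightarrow> (real^'d1 \<Rightarrow> real^'q^'q)
      \<Rightarrow> real^('d1::finite + 'd2::finite) \<Rightarrow> real^'r \<Rightarrow> real^('d1 + 'd2)"
  where "score \<nu> h \<Lambda> \<theta> y = gradient (\<lambda>\<theta>'. ln (marg_density \<nu> h \<Lambda> \<theta>' y)) \<theta>"

definition fisher_info ::
    "(real^'q) measure \<Rightarrow> (real^'r) measure \<Rightarrow> (real^'r \<Rightarrow> real^'d2 \<Rightarrow> real^'q \<Rightarrow> real)
      \<Rightarrow> (real^'d1 \<Rightarrow> real^'q^'q) \<Rightarrow> real^('d1::finite + 'd2::finite)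
      \<Rightarrow> real^('d1::finite + 'd2::finite)^('d1 + 'd2)"
  where "fisher_info \<nu> \<gamma> h \<Lambda> \<theta> = cov_matrix (obs_law \<nu> \<gamma> h \<Lambda> \<theta>) (score \<nu> h \<Lambda> \<theta>)"

text \<open>
  The score of the \<open>m\<close>th scale parameter at the observation \<open>y\<close> may be computed by
  differentiating under the integral. The derivatives of \<open>w \<mapsto> f\<^sub>\<theta>(y | w)\<close> and
  of \<open>h y \<psi>\<close> at \<open>\<Lambda> w\<close> are required for almost every \<open>w\<close> only.
\<close>

definition score_interchange ::
    "(real^'q) measure \<Rightarrow> (real^'r \<Rightarrow> real^'d2 \<Rightarrow> real^'q \<Rightarrow> real) \<Rightarrow> (real^'d1 \<Rightarrow> real^'q^'q)
      \<Rightarrow> real^('d1::finite + 'd2::finite) \<Rightarrow> 'd1 \<Rightarrow> real^'r \<Rightarrow> bool"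
  where "score_interchange \<nu> h \<Lambda> \<theta> m y \<longleftrightarrow>
    (let f = marg_density \<nu> h \<Lambda> \<theta> y;
         D1 = (\<lambda>w. partial (Inl m) (\<lambda>\<theta>'. cond_density h \<Lambda> \<theta>' y w) \<theta>);
         D2 = (\<lambda>w. gradient (h y (psi_part \<theta>)) (\<Lambda> (scale_part \<theta>) *v w)
                    \<bullet> (partial_mat m \<Lambda> (scale_part \<theta>) *v w))
     in partially_differentiable (Inl m) (\<lambda>\<theta>'. marg_density \<nu> h \<Lambda> \<theta>' y) \<theta> \<and>
        (AE w in \<nu>. partially_differentiable (Inl m) (\<lambda>\<theta>'. cond_density h \<Lambda> \<theta>' y w) \<theta>) \<and>
        (AE w in \<nu>. \<forall>l. partially_differentiable l (h y (psi_part \<theta>))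
                            (\<Lambda> (scale_part \<theta>) *v w)) \<and>
        integrable \<nu> D1 \<and> integrable \<nu> D2 \<and>
        score \<nu> h \<Lambda> \<theta> y $ Inl m = (1 / f) * (\<integral>w. D1 w \<partial>\<nu>) \<and>
        (1 / f) * (\<integral>w. D1 w \<partial>\<nu>) = (1 / f) * (\<integral>w. D2 w \<partial>\<nu>))"

end

theory Submission
  imports Defs
begin

text \<open>
  If \<open>\<lambda>\<^sub>j = 0\<close>, then \<open>\<Lambda> w\<close> does not depend on the random effects \<open>w\<^sub>l\<close> scaled by \<open>\<lambda>\<^sub>j\<close>, whereas
  \<open>\<nabla>\<^sub>j\<Lambda> w\<close> depends linearly on exactly those. By independence and mean zero, the integral in the
  score vanishes, so the \<open>j\<close>th score component is almost surely zero and has no covariance with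
  any other.
\<close>

text \<open>Zero filling, rather than restriction to a function on \<open>A\<close>, keeps both
  halves of \<open>w\<close> in \<open>real^'q\<close>, so that they add up to \<open>w\<close> and
  can be multiplied by matrices.\<close>

definition coords_on :: "'n set \<Rightarrow> real^'n \<Rightarrow> real^'n"
  where "coords_on A w = (\<chi> l. if l \<in> A then w $ l else 0)"

lemma coords_on_nth [simp]: "coords_on A w $ l = (if l \<in> A then w $ l else 0)"
  by (simp add: coords_on_def)

lemma coords_on_add_Compl [simp]: "coords_on A w + coords_on (- A) w = w"
  by (simp add: vec_eq_iff)

lemma borel_measurable_vec_lambda:
  fixes f :: "'a \<Rightarrow> 'n::finite \<Rightarrow> real"
  assumes "\<And>l. (\<lambda>x. f x l) \<in> borel_measurable M"
  shows "(\<lambda>x. \<chi> l. f x l) \<in> borel_measurable M"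
  using assms by (subst borel_measurable_euclidean_space) (auto simp: Basis_vec_def inner_axis)

lemma coords_on_measurable [measurable]: "coords_on A \<in> borel_measurable borel"
  unfolding coords_on_def by (intro borel_measurable_vec_lambda) auto

lemma random_effects_law_integrable:
  fixes \<nu> :: "(real^'q::finite) measure"
  assumes "random_effects_law \<nu>"
  shows "integrable \<nu> (\<lambda>w. w $ l)"
proof -
  interpret prob_space \<nu>
    using assms by (simp add: random_effects_law_def)
  have [measurable_cong]: "sets \<nu> = sets borel"
    and "expectation (\<lambda>w. w $ l) = 0" and "variance (\<lambda>w. w $ l) = 1"
    using assms unfolding random_effects_law_def by blast+
  then have var: "expectation (\<lambda>w. (w $ l)\<^sup>2) = 1"
    by simp
  \<comment> \<open>A non-integrable square would have integral 0 by default, not 1.\<close>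
  have "integrable \<nu> (\<lambda>w. (w $ l)\<^sup>2)"
    using var not_integrable_integral_eq[of \<nu> "\<lambda>w. (w $ l)\<^sup>2"] by fastforce
  then show ?thesis
    by (rule square_integrable_imp_integrable[rotated]) measurable
qed

text \<open>Subfamilies of independent variables over disjoint index sets are independent, and zero
  filling is a measurable function of each subfamily.\<close>

lemma random_effects_law_indep_coords_on:
  fixes \<nu> :: "(real^'q::finite) measure"
  assumes "random_effects_law \<nu>"
  shows "prob_space.indep_var \<nu> borel (coords_on A) borel (coords_on (- A))"
proof -
  interpret prob_space \<nu>
    using assms by (simp add: random_effects_law_def)
  have meas: "(\<lambda>f. \<chi> l. if l \<in> B then f l else (0::real)) \<in> measurable (PiM B (\<lambda>_. borel)) borel"
    for B :: "'q set"
  proof (rule borel_measurable_vec_lambda)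
    show "(\<lambda>f. if l \<in> B then f l else (0::real)) \<in> borel_measurable (PiM B (\<lambda>_. borel))" for l
      by (cases "l \<in> B") auto
  qed
  have comp: "(\<lambda>f. \<chi> l. if l \<in> B then f l else 0) \<circ> (\<lambda>w. restrict (\<lambda>l. w $ l) B) = coords_on B"
    for B :: "'q set"
    by (auto simp: fun_eq_iff vec_eq_iff)
  have "indep_vars (\<lambda>_. borel) (\<lambda>l w. w $ l) UNIV"
    using assms by (simp add: random_effects_law_def)
  then have "indep_var (PiM A (\<lambda>_. borel)) (\<lambda>w. restrict (\<lambda>l. w $ l) A)
                       (PiM (- A) (\<lambda>_. borel)) (\<lambda>w. restrict (\<lambda>l. w $ l) (- A))"
    by (rule indep_var_restrict) auto
  from indep_var_compose[OF this meas meas] show ?thesis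
    by (simp only: comp)
qed

text \<open>
  The single summands of \<open>g\<close> need not be integrable, and \<open>G\<close> need not be measurable; hence
  integrate over the coordinates in \<open>A\<close> first, with the others fixed.
\<close>

lemma integral_linear_in_coords_eq_0:
  fixes \<nu> :: "(real^'q::finite) measure" and G :: "real^'q \<Rightarrow> 'q \<Rightarrow> real"
  assumes law: "random_effects_law \<nu>"
    and int: "integrable \<nu> g"
    and g: "\<And>w. g w = (\<Sum>l\<in>A. G (coords_on (- A) w) l * w $ l)"
  shows "integral\<^sup>L \<nu> g = 0"
proof -
  interpret prob_space \<nu>
    using law by (simp add: random_effects_law_def)
  have [measurable_cong]: "sets \<nu> = sets borel"
    and mean: "expectation (\<lambda>w. w $ l) = 0" for l
    using law by (auto simp: random_effects_law_def)
  \<comment> \<open>Measurability has to come from integrability, since the coefficients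
    \<open>G\<close> are arbitrary.\<close>
  have [measurable]: "g \<in> borel_measurable borel"
    using borel_measurable_integrable[OF int] by measurable
  define P where "P = distr \<nu> borel (coords_on A)"
  define Q where "Q = distr \<nu> borel (coords_on (- A))"
  interpret P: prob_space P unfolding P_def by (rule prob_space_distr) measurable
  interpret Q: prob_space Q unfolding Q_def by (rule prob_space_distr) measurable
  interpret PQ: pair_sigma_finite P Q ..
  have [measurable_cong]: "sets P = sets borel" "sets Q = sets borel"
    by (simp_all add: P_def Q_def)
  have joint: "P \<Otimes>\<^sub>M Q = distr \<nu> (borel \<Otimes>\<^sub>M borel) (\<lambda>w. (coords_on A w, coords_on (- A) w))"
    using random_effects_law_indep_coords_on[OF law, of A]
    by (simp add: indep_var_distribution_eq P_def Q_def)
  have intPQ: "integrable (P \<Otimes>\<^sub>M Q) (\<lambda>(a, b). g (a + b))"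
    unfolding joint by (subst integrable_distr_eq) (use int in auto)
  have inner0: "(\<integral>a. g (a + coords_on (- A) w) \<partial>P) = 0" for w
  proof -
    \<comment> \<open>Replacing the coordinates in \<open>A\<close> by those of \<open>v\<close>
      leaves the coefficients fixed, so the integrand becomes a finite linear combination of
      integrable coordinates of mean zero.\<close>
    have eq: "g (coords_on A v + coords_on (- A) w) = (\<Sum>l\<in>A. G (coords_on (- A) w) l * v $ l)" for v
    proof -
      have "coords_on (- A) (coords_on A v + coords_on (- A) w) = coords_on (- A) w"
        by (auto simp: vec_eq_iff)
      then show ?thesis by (simp add: g)
    qed
    have "(\<integral>a. g (a + coords_on (- A) w) \<partial>P) = (\<integral>v. g (coords_on A v + coords_on (- A) w) \<partial>\<nu>)"
      unfolding P_def by (subst integral_distr) auto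
    also have "\<dots> = (\<Sum>l\<in>A. G (coords_on (- A) w) l * expectation (\<lambda>v. v $ l))"
      unfolding eq using random_effects_law_integrable[OF law] by (subst Bochner_Integration.integral_sum) auto
    finally show ?thesis by (simp add: mean)
  qed
  have "integral\<^sup>L \<nu> g = integral\<^sup>L (P \<Otimes>\<^sub>M Q) (\<lambda>(a, b). g (a + b))"
    unfolding joint by (subst integral_distr) auto
  also have "\<dots> = (\<integral>b. (\<integral>a. g (a + b) \<partial>P) \<partial>Q)"
    using PQ.integral_snd[OF intPQ] by simp
  \<comment> \<open>Pulling the outer integral back to \<open>\<nu>\<close> restricts
    \<open>b\<close> to values of \<open>coords_on (- A)\<close>, where \<open>inner0\<close>
    applies.\<close>
  also have "\<dots> = (\<integral>w. (\<integral>a. g (a + coords_on (- A) w) \<partial>P) \<partial>\<nu>)"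
    unfolding Q_def by (subst integral_distr) auto
  finally show ?thesis by (simp add: inner0)
qed

lemma diag_mult_vec: "diag v *v w = (\<chi> l. v $ l * w $ l)"
  by (simp add: diag_def matrix_vector_mult_def vec_eq_iff if_distrib[of "\<lambda>x. x * _"] cong: if_cong)

lemma partial_nth: "partial m (\<lambda>z. z $ i) x = (if i = m then 1 else 0)"
proof -
  have "((\<lambda>t::real. (x + t *\<^sub>R axis m 1) $ i) has_field_derivative axis m 1 $ i) (at 0)"
    by (auto intro!: derivative_eq_intros)
  then show ?thesis
    unfolding partial_def by (simp add: DERIV_imp_deriv axis_def)
qed

lemma partial_const: "partial m (\<lambda>z. c) x = 0"
  by (simp add: partial_def)

text \<open>Off-diagonal entries are constant and diagonal ones are coordinates of the argument; a
  parameter repeated along the diagonal gives several ones.\<close>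

lemma partial_mat_diag:
  "partial_mat m (\<lambda>z. diag (\<chi> l. z $ pos l)) x = diag (\<chi> l. if pos l = m then 1 else 0)"
proof -
  have "partial m (\<lambda>z. diag (\<chi> l. z $ pos l) $ k $ l) x
      = diag (\<chi> l. if pos l = m then 1 else 0) $ k $ l" for k l
    by (cases "k = l") (simp_all add: diag_def partial_nth partial_const)
  then show ?thesis by (simp add: partial_mat_def vec_eq_iff)
qed

lemma score_scale_eq_0:
  assumes law: "random_effects_law \<nu>"
    and inter: "score_interchange \<nu> h \<Lambda> \<theta> j y"
    and \<Lambda>: "\<And>lam. \<Lambda> lam = diag (\<chi> l. lam $ pos l)"
    and zero: "\<theta> $ Inl j = 0"
  shows "score \<nu> h \<Lambda> \<theta> y $ Inl j = 0"
proof -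
  define A where "A = {l. pos l = j}"
  define D where "D = (\<lambda>w. gradient (h y (psi_part \<theta>)) (\<Lambda> (scale_part \<theta>) *v w)
                    \<bullet> (partial_mat j \<Lambda> (scale_part \<theta>) *v w))"
  have int: "integrable \<nu> D"
    and score: "score \<nu> h \<Lambda> \<theta> y $ Inl j = (1 / marg_density \<nu> h \<Lambda> \<theta> y) * integral\<^sup>L \<nu> D"
    using inter by (auto simp: score_interchange_def D_def Let_def)
  have \<Lambda>_eq: "\<Lambda> = (\<lambda>z. diag (\<chi> l. z $ pos l))"
    using \<Lambda> by blast
  \<comment> \<open>The coordinates in \<open>A\<close> are exactly those multiplied by the
    parameter at \<open>Inl j\<close>, which is 0.\<close>
  have "\<Lambda> (scale_part \<theta>) *v w = \<Lambda> (scale_part \<theta>) *v coords_on (- A) w" for w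
    using zero by (auto simp: \<Lambda>_eq diag_mult_vec vec_eq_iff scale_part_def A_def)
  moreover have "partial_mat j \<Lambda> (scale_part \<theta>) *v w = coords_on A w" for w
    by (auto simp: \<Lambda>_eq partial_mat_diag diag_mult_vec vec_eq_iff A_def)
  ultimately have "D w = (\<Sum>l\<in>A. gradient (h y (psi_part \<theta>))
      (\<Lambda> (scale_part \<theta>) *v coords_on (- A) w) $ l * w $ l)" for w
    by (simp add: D_def inner_vec_def if_distrib[of "\<lambda>x. _ * x"] sum.If_cases cong: if_cong)
  from integral_linear_in_coords_eq_0[OF law int this] show ?thesis
    by (simp add: score)
qed

text \<open>This lets null sets of \<open>obs_law\<close> be described through
  \<open>\<gamma>\<close>. The conditional density is jointly measurable in \<open>(y, w)\<close>,
  so integrating out \<open>w\<close> preserves measurability.\<close>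

lemma marg_density_measurable:
  assumes model: "mixed_model \<Theta> \<nu> \<gamma> h \<Lambda>" and "\<theta> \<in> \<Theta>"
  shows "marg_density \<nu> h \<Lambda> \<theta> \<in> borel_measurable \<gamma>"
proof -
  interpret prob_space \<nu>
    using model by (simp add: mixed_model_def random_effects_law_def)
  have [measurable_cong]: "sets \<nu> = sets borel" "sets \<gamma> = sets borel"
    and h: "(\<lambda>(y, u). h y (psi_part \<theta>) u) \<in> borel_measurable (borel \<Otimes>\<^sub>M borel)"
    using assms by (auto simp: mixed_model_def random_effects_law_def)
  have [measurable]: "(\<lambda>w. \<Lambda> (scale_part \<theta>) *v w) \<in> borel_measurable borel"
    by (intro borel_measurable_continuous_onI linear_continuous_on)
       (simp add: linear_linear)
  have "(\<lambda>(y, w). (y, \<Lambda> (scale_part \<theta>) *v w)) \<in> measurable (\<gamma> \<Otimes>\<^sub>M \<nu>) (borel \<Otimes>\<^sub>M borel)"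
    by measurable
  from measurable_compose[OF this h]
  have "(\<lambda>(y, w). cond_density h \<Lambda> \<theta> y w) \<in> borel_measurable (\<gamma> \<Otimes>\<^sub>M \<nu>)"
    by (simp add: cond_density_def case_prod_beta')
  then show ?thesis
    unfolding marg_density_def by (rule borel_measurable_lebesgue_integral)
qed

text \<open>Component \<open>k\<close> has mean 0, so its centred version is almost everywhere 0; so
  is its product with any other centred component, whatever value the mean of the latter
  takes.\<close>

lemma cov_matrix_column_eq_0:
  assumes "AE s in M. X s $ k = 0"
  shows "cov_matrix M X *v axis k 1 = 0"
proof -
  have "(\<integral>s. X s $ k \<partial>M) = 0"
    using assms by (rule integral_eq_zero_AE)
  then have "cov_matrix M X $ i $ k = 0" for i
    unfolding cov_matrix_def using assms by (auto intro!: integral_eq_zero_AE)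
  then show ?thesis
    by (simp add: matrix_vector_mult_basis column_def vec_eq_iff)
qed

theorem corollary3p2:
  fixes \<Theta> :: "(real^('d1::finite + 'd2::finite)) set"
    and \<theta> :: "real^('d1 + 'd2)"
    and \<nu> :: "(real^'q::finite) measure"
    and \<gamma> :: "(real^'r::finite) measure"
    and h :: "real^'r \<Rightarrow> real^'d2 \<Rightarrow> real^'q \<Rightarrow> real"
    and \<Lambda> :: "real^'d1 \<Rightarrow> real^'q^'q"
    and pos :: "'q \<Rightarrow> 'd1"
    and j :: 'd1
  assumes "mixed_model \<Theta> \<nu> \<gamma> h \<Lambda>"
    and "\<theta> \<in> \<Theta>"
    and "\<forall>m. AE y in \<gamma>. marg_density \<nu> h \<Lambda> \<theta> y > 0 \<longrightarrow> score_interchange \<nu> h \<Lambda> \<theta> m y"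
    and "\<forall>lam. \<Lambda> lam = diag (\<chi> l. lam $ pos l)"
    and "\<theta> $ Inl j = 0"
  shows "fisher_info \<nu> \<gamma> h \<Lambda> \<theta> *v axis (Inl j) 1 = 0"
proof -
  have law: "random_effects_law \<nu>"
    using assms(1) by (simp add: mixed_model_def)
  have "AE y in \<gamma>. 0 < marg_density \<nu> h \<Lambda> \<theta> y \<longrightarrow> score \<nu> h \<Lambda> \<theta> y $ Inl j = 0"
    using assms(3)[rule_format, of j] score_scale_eq_0[OF law _ assms(4)[rule_format] assms(5)]
    by auto
  \<comment> \<open>Points where the marginal density is not positive form a null set of
    \<open>obs_law\<close>, so the interchange is available almost surely.\<close>
  then have "AE y in obs_law \<nu> \<gamma> h \<Lambda> \<theta>. score \<nu> h \<Lambda> \<theta> y $ Inl j = 0"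
    unfolding obs_law_def using marg_density_measurable[OF assms(1,2)]
    by (subst AE_density) auto
  then show ?thesis
    unfolding fisher_info_def by (rule cov_matrix_column_eq_0)
qed

end
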